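(* Let $(f_j)_{j\ge 1}$ be a probability distribution on the positive integers (so $f_j\ge 0$ and $\sum_{j\ge 1} f_j = 1$) such that, for some finite $S$, $f_j = 0$ for all $j > S$. Let $X$ be a random variable with $P(X=j)=f_j$ for $j\ge 1$, let $X_1, X_2, \dots$ be independent random variables each with the distribution of $X$, and for $n \ge 0$ let $u_n$ be the probability that there exists $k\ge 0$ with $X_1+\cdots+X_k = n$. Then $u_n$ has a finite limit as $n\to\infty$, this being $$\lim_{n\to\infty} u_n = \frac{1}{E[X]},$$ where $E[X]=\sum_{j\ge 1} j f_j$ is the expected value of $X$.
   Context: A counter starts at square $0$ of the semi-infinite line of squares $0,1,2,\dots$ and makes successive independent jumps forward, each of length distributed as $X$. The number $u_n$ is the probability that the counter ever lands on square $n$. The empty sum ($k=0$) equals $0$, so $u_0=1$.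
   Formalization: The formal theorem adds the hypothesis that the greatest common divisor of all j ≥ 1 with f_j > 0 is 1; without it the claim is false, e.g. for f_2 = 1, where u_n alternates between 1 and 0. *)

theory Defs
  imports "HOL-Probability.Probability"
begin

text \<open>
  Jumps are indexed from 1, so \<open>X 0\<close> is never used; the case \<open>k = 0\<close> is the starting square.
\<close>

definition landing_prob :: "'a measure \<Rightarrow> (nat \<Rightarrow> 'a \<Rightarrow> nat) \<Rightarrow> nat \<Rightarrow> real" where
  "landing_prob M X n = measure M {\<omega> \<in> space M. \<exists>k. (\<Sum>i=1..k. X i \<omega>) = n}"

end

theory Submission
  imports Defs
begin

text \<open>
  Conditioning on the length of the jump that reaches square \<open>n\<close> gives the renewal equation
  \<open>u n = (\<Sum>j=1..n. f j * u (n - j))\<close> (\<open>landing_prob_renewal\<close>), and the rest is about real sequences.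
  For \<open>n \<ge> S\<close> the equation says that \<open>u n\<close> is a weighted average of the \<open>S\<close> preceding values.
  Look at times along which \<open>u\<close> approaches its upper limit \<open>L\<close>. An average is near its upper bound
  only if all its terms are, so \<open>u\<close> is also near \<open>L\<close> a delay \<open>j\<close> earlier, for each possible jump
  length \<open>j\<close>, and hence for each sum of jump lengths. The jump lengths have greatest common divisor 1,
  so every large number is such a sum, and somewhere \<open>u\<close> is near \<open>L\<close> on a full window of length \<open>S\<close>.

  The value of \<open>L\<close> comes from a conserved quantity: with the tails \<open>r j = P(X > j)\<close>, the
  sum of the \<open>r j * u (n - j)\<close> is 1 for every \<open>n\<close>, as it partitions the sample space by the last
  square visited up to \<open>n\<close>. On the window this reads \<open>L * (\<Sum>j<S. r j) = 1\<close>,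
  and the tails sum to the mean of the jump. The same argument for \<open>- u\<close> gives the lower limit the same value
  (\<open>limsup_of_moving_average\<close>, \<open>renewal_sequence_limit\<close>).
\<close>

section \<open>Numerical semigroups\<close>

text \<open>
  The differences of elements of an additive monoid of naturals form a subgroup of \<open>\<int>\<close>, whose least
  positive element \<open>d\<close> divides all of \<open>A\<close>; so \<open>d = 1\<close> and the monoid has consecutive elements \<open>x\<close> and
  \<open>x + 1\<close>. Every \<open>n \<ge> x\<^sup>2\<close> is a sum of copies of these two. Asking \<open>H\<close> only to absorb
  elements of \<open>A\<close> is what is checkable in the application; the monoid is its stabiliser \<open>G\<close>.
\<close>

lemma numerical_semigroup_cofinite:
  fixes A H :: "nat set"
  assumes gcd: "Gcd A = 1" and zero: "0 \<in> H"
    and add: "\<And>h a. h \<in> H \<Longrightarrow> a \<in> A \<Longrightarrow> h + a \<in> H"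
  shows "\<exists>m. \<forall>n\<ge>m. n \<in> H"
proof -
  define G where "G = {g. \<forall>h\<in>H. h + g \<in> H}"
  have G0: "0 \<in> G" by (simp add: G_def)
  have G_add: "x + y \<in> G" if "x \<in> G" "y \<in> G" for x y
    using that by (auto simp: G_def add.assoc[symmetric])
  have G_mult: "k * x \<in> G" if "x \<in> G" for x k
    by (induction k) (use that G0 G_add in auto)
  have AG: "A \<subseteq> G" using add by (auto simp: G_def)
  have GH: "G \<subseteq> H" using zero by (force simp: G_def)
  have "\<exists>a\<in>A. a > 0"
  proof (rule ccontr)
    assume "\<not> ?thesis"
    then have "A \<subseteq> {0}" by auto
    then have "Gcd A = 0" by simp
    then show False using gcd by simp
  qed
  then obtain a where a: "a \<in> A" "a > 0" by blast
  \<comment> \<open>\<open>P d\<close>: \<open>d\<close> is a positive difference of two elements of \<open>G\<close>.\<close>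
  define P where "P d \<longleftrightarrow> d > 0 \<and> (\<exists>x\<in>G. x + d \<in> G)" for d
  define d where "d = (LEAST d. P d)"
  have "P a" using a AG G0 by (auto simp: P_def intro!: bexI[of _ 0])
  then have "P d" and d_least: "\<And>e. P e \<Longrightarrow> d \<le> e"
    unfolding d_def by (auto intro: LeastI Least_le)
  then obtain x where x: "d > 0" "x \<in> G" "x + d \<in> G" by (auto simp: P_def)
  have "d dvd b" if "b \<in> A" for b
  proof (rule ccontr)
    assume nd: "\<not> d dvd b"
    define q where "q = b div d"
    have r: "b mod d > 0" using nd by (simp add: dvd_eq_mod_eq_0)
    \<comment> \<open>The remainder of \<open>b\<close> is itself a difference, namely of \<open>q * x + b\<close> and \<open>q * (x + d)\<close>.\<close>
    have "q * (x + d) + b mod d = q * x + b"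
      by (simp add: q_def algebra_simps)
    also have "\<dots> \<in> G" using that AG x G_mult G_add by blast
    finally have "P (b mod d)" using r x G_mult unfolding P_def by blast
    then have "d \<le> b mod d" by (rule d_least)
    then show False using mod_less_divisor[OF x(1), of b] by linarith
  qed
  then have "d dvd Gcd A" by (simp add: Gcd_greatest)
  then have "d = 1" using gcd by simp
  then have x1: "x + 1 \<in> G" using x by simp
  have "n \<in> H" if n: "n \<ge> x * x" for n
  proof (cases "x = 0")
    case True
    then show ?thesis using G_mult[OF x1, of n] GH by auto
  next
    case False
    define q r where "q = n div x" and "r = n mod x"
    have "r < x" using False by (simp add: r_def)
    moreover have "x \<le> q" using n False by (simp add: q_def less_eq_div_iff_mult_less_eq)
    ultimately have "q = (q - r) + r" by simp
    then have "n = ((q - r) + r) * x + r" by (simp add: q_def r_def)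
    also have "\<dots> = (q - r) * x + r * (x + 1)" by (simp add: algebra_simps)
    also have "\<dots> \<in> G" using G_add G_mult x x1 by blast
    finally show ?thesis using GH by blast
  qed
  then show ?thesis by blast
qed

section \<open>Convergence of renewal sequences\<close>

text \<open>
  A maximum principle: a weighted average can reach the upper bound \<open>L\<close> only if every term of
  positive weight does. Here both the bound and its attainment
  are asymptotic, the latter along the times \<open>\<phi> k\<close>.
\<close>

lemma limit_at_maximum_propagates:
  fixes f v :: "nat \<Rightarrow> real"
  assumes nonneg: "\<And>j. j \<in> {1..S} \<Longrightarrow> f j \<ge> 0" and sum1: "(\<Sum>j=1..S. f j) = 1"
    and average: "\<And>n. n \<ge> S \<Longrightarrow> v n = (\<Sum>j=1..S. f j * v (n - j))"
    and upper: "\<And>e. e > 0 \<Longrightarrow> eventually (\<lambda>n. v n < L + e) sequentially"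
    and \<phi>: "filterlim \<phi> sequentially sequentially" and lim: "(\<lambda>k. v (\<phi> k)) \<longlonglongrightarrow> L"
    and j: "j \<in> {1..S}" "f j > 0"
  shows "(\<lambda>k. v (\<phi> k - j)) \<longlonglongrightarrow> L"
proof -
  have shift: "filterlim (\<lambda>k. \<phi> k - i) sequentially sequentially" for i
    using filterlim_compose[OF filterlim_minus_const_nat_at_top \<phi>] by simp
  have upper': "eventually (\<lambda>k. v (\<phi> k - i) < L + e) sequentially" if "e > 0" for e i
    using eventually_compose_filterlim[OF upper[OF that] shift] .
  show ?thesis
  proof (rule order_tendstoI)
    fix a assume "a > L"
    then show "eventually (\<lambda>k. v (\<phi> k - j) < a) sequentially"
      using upper'[of "a - L"] by simp
  next
    fix a assume "a < L"
    \<comment> \<open>If the term \<open>j\<close> were at most \<open>a\<close>, the average would fall short of \<open>L\<close> by about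
      \<open>f j * (L - a)\<close>; half of that leaves room for the errors in the average and in the other terms.\<close>
    define e where "e = f j * (L - a) / 2"
    have e: "e > 0" using j \<open>a < L\<close> by (simp add: e_def)
    have "eventually (\<lambda>k. \<forall>i\<in>{1..S}. v (\<phi> k - i) < L + e) sequentially"
      using upper'[OF e] by (simp add: eventually_ball_finite)
    moreover have "eventually (\<lambda>k. v (\<phi> k) > L - e) sequentially"
      using order_tendstoD(1)[OF lim] e by simp
    moreover have "eventually (\<lambda>k. \<phi> k \<ge> S) sequentially"
      using \<phi> by (auto simp: filterlim_at_top)
    ultimately show "eventually (\<lambda>k. a < v (\<phi> k - j)) sequentially"
    proof eventually_elim
      case (elim k)
      let ?J = "{1..S} - {j}"
      have rest: "(\<Sum>i\<in>?J. f i) = 1 - f j"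
        using sum1 j by (simp add: sum_diff1)
      have "L - e < f j * v (\<phi> k - j) + (\<Sum>i\<in>?J. f i * v (\<phi> k - i))"
        using elim average[of "\<phi> k"] j by (simp add: sum.remove[of _ j])
      also have "(\<Sum>i\<in>?J. f i * v (\<phi> k - i)) \<le> (\<Sum>i\<in>?J. f i * (L + e))"
        using elim nonneg by (intro sum_mono mult_left_mono) (auto intro: less_imp_le)
      also have "\<dots> = (1 - f j) * (L + e)"
        by (simp only: rest flip: sum_distrib_right)
      finally have "f j * v (\<phi> k - j) > f j * L - 2 * e + f j * e"
        by (simp add: algebra_simps)
      moreover have "f j * e > 0" using e j by simp
      moreover have "2 * e = f j * L - f j * a" by (simp add: e_def right_diff_distrib)
      ultimately have "f j * v (\<phi> k - j) > f j * a" by linarith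
      then show ?case using j by simp
    qed
  qed
qed

text \<open>
  Let \<open>L\<close> be the upper limit of \<open>v\<close>, attained along times \<open>\<phi> k\<close>. By the maximum principle the
  delays \<open>a\<close> with \<open>v (\<phi> k - a) \<longlonglongrightarrow> L\<close> are stable under adding any \<open>j\<close> of positive weight, so
  aperiodicity makes all large delays qualify. Then a whole window of \<open>S\<close> consecutive values tends
  to \<open>L\<close>, and the conserved quantity evaluated on that window forces \<open>L * (\<Sum>j<S. r j) = c\<close>.
  The conclusion is a one-sided bound, for an arbitrary sign of \<open>c\<close>, so that it yields the lower limit
  when it is applied to \<open>- v\<close>.
\<close>

lemma limsup_of_moving_average:
  fixes f v r :: "nat \<Rightarrow> real"
  assumes nonneg: "\<And>j. j \<in> {1..S} \<Longrightarrow> f j \<ge> 0" and sum1: "(\<Sum>j=1..S. f j) = 1"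
    and aperiodic: "Gcd {j \<in> {1..S}. f j > 0} = 1"
    and average: "\<And>n. n \<ge> S \<Longrightarrow> v n = (\<Sum>j=1..S. f j * v (n - j))"
    and bounded: "\<And>n. \<bar>v n\<bar> \<le> B"
    and conserved: "\<And>n. n \<ge> S \<Longrightarrow> (\<Sum>j<S. r j * v (n - j)) = c"
    and mass: "(\<Sum>j<S. r j) \<noteq> 0" and e: "e > 0"
  shows "eventually (\<lambda>n. v n < c / (\<Sum>j<S. r j) + e) sequentially"
proof -
  obtain \<phi> where \<phi>: "strict_mono \<phi>" 
    and lim': "((\<lambda>n. ereal (v n)) \<circ> \<phi>) \<longlonglongrightarrow> limsup (\<lambda>n. ereal (v n))"
    using limsup_subseq_lim by blast
  have "limsup (\<lambda>n. ereal (v n)) \<le> ereal B"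
    using bounded by (intro Limsup_bounded always_eventually) (auto simp: abs_le_iff)
  moreover have "ereal (- B) \<le> limsup (\<lambda>n. ereal (v n))"
    using bounded by (intro le_Limsup always_eventually) (auto simp: abs_le_iff minus_le_iff)
  ultimately obtain L where L: "limsup (\<lambda>n. ereal (v n)) = ereal L"
    by (cases "limsup (\<lambda>n. ereal (v n))") auto
  have lim: "(\<lambda>k. v (\<phi> k)) \<longlonglongrightarrow> L" using lim' by (simp add: L o_def)
  have upper: "eventually (\<lambda>n. v n < L + e) sequentially" if "e > 0" for e
  proof -
    have "limsup (\<lambda>n. ereal (v n)) < ereal (L + e)" using that by (simp add: L)
    from Limsup_lessD[OF this] show ?thesis by simp
  qed
  have \<phi>_top: "filterlim \<phi> sequentially sequentially"
    using \<phi> by (rule filterlim_subseq)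
  define H where "H = {a. (\<lambda>k. v (\<phi> k - a)) \<longlonglongrightarrow> L}"
  have "\<exists>m. \<forall>n\<ge>m. n \<in> H"
  proof (rule numerical_semigroup_cofinite[OF aperiodic])
    show "0 \<in> H" using lim by (simp add: H_def)
    fix h j assume h: "h \<in> H" and j: "j \<in> {j \<in> {1..S}. f j > 0}"
    have "filterlim (\<lambda>k. \<phi> k - h) sequentially sequentially"
      using filterlim_compose[OF filterlim_minus_const_nat_at_top \<phi>_top] by simp
    from limit_at_maximum_propagates[OF nonneg sum1 average upper this] h j
    have "(\<lambda>k. v (\<phi> k - h - j)) \<longlonglongrightarrow> L" by (auto simp: H_def)
    then show "h + j \<in> H" by (simp add: H_def)
  qed
  then obtain m where m: "\<And>n. n \<ge> m \<Longrightarrow> n \<in> H" by blast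
  have "(\<lambda>k. \<Sum>j<S. r j * v (\<phi> k - m - j)) \<longlonglongrightarrow> (\<Sum>j<S. r j * L)"
    using m by (intro tendsto_sum tendsto_mult_left) (simp add: H_def)
  moreover have "eventually (\<lambda>k. (\<Sum>j<S. r j * v (\<phi> k - m - j)) = c) sequentially"
  proof -
    have "eventually (\<lambda>k. \<phi> k \<ge> m + S) sequentially"
      using \<phi>_top by (auto simp: filterlim_at_top)
    then show ?thesis by eventually_elim (rule conserved, simp)
  qed
  ultimately have "(\<lambda>k. c) \<longlonglongrightarrow> (\<Sum>j<S. r j * L)" by (rule Lim_transform_eventually)
  then have "c = (\<Sum>j<S. r j) * L"
    by (simp add: LIMSEQ_const_iff sum_distrib_right)
  then have "L = c / (\<Sum>j<S. r j)" using mass by (simp add: field_simps)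
  then show ?thesis using upper[OF e] by simp
qed

text \<open>
  The conserved quantity is built from the tails \<open>r j = 1 - (f 1 + \<dots> + f j)\<close>. Probabilistically,
  \<open>r j * u (n - j)\<close> is the chance that \<open>n - j\<close> is the last square visited up to \<open>n\<close>, so these
  products sum to 1; and the tails sum to the mean.
\<close>

lemma renewal_sequence_limit:
  fixes f u :: "nat \<Rightarrow> real"
  assumes nonneg: "\<And>j. j \<ge> 1 \<Longrightarrow> f j \<ge> 0" and sum1: "(\<Sum>j=1..S. f j) = 1"
    and support: "\<And>j. j > S \<Longrightarrow> f j = 0"
    and aperiodic: "Gcd {j. j \<ge> 1 \<and> f j > 0} = 1"
    and u0: "u 0 = 1"
    and renewal: "\<And>n. n \<ge> 1 \<Longrightarrow> u n = (\<Sum>j=1..n. f j * u (n - j))"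
    and bounded: "\<And>n. \<bar>u n\<bar> \<le> B"
  shows "u \<longlonglongrightarrow> 1 / (\<Sum>j=1..S. real j * f j)"
proof -
  define r where "r j = 1 - (\<Sum>i=1..j. f i)" for j
  define \<mu> where "\<mu> = (\<Sum>j=1..S. real j * f j)"
  have S: "S \<ge> 1" using sum1 by (cases S) auto
  \<comment> \<open>Once \<open>n \<ge> S\<close>, the renewal equation becomes an average over a window of fixed length.\<close>
  have trunc: "(\<Sum>j=1..n. f j * g j) = (\<Sum>j=1..S. f j * g j)" if "n \<ge> S" for n and g :: "nat \<Rightarrow> real"
    using that support by (intro sum.mono_neutral_right) auto
  have r0: "r j = 0" if "j \<ge> S" for j
    using trunc[OF that, of "\<lambda>_. 1"] sum1 by (simp add: r_def)
  have average: "u n = (\<Sum>j=1..S. f j * u (n - j))" if "n \<ge> S" for n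
    using renewal[of n] trunc[OF that] that S by simp
  have conserved: "(\<Sum>j\<le>n. r j * u (n - j)) = 1" for n
  proof (induction n)
    case 0
    then show ?case by (simp add: r_def u0)
  next
    case (Suc n)
    have "(\<Sum>j\<le>Suc n. r j * u (Suc n - j)) = u (Suc n) + (\<Sum>j\<le>n. r (Suc j) * u (n - j))"
      by (simp add: sum.atMost_Suc_shift r_def del: sum.atMost_Suc)
    also have "\<dots> = u (Suc n) + (\<Sum>j\<le>n. r j * u (n - j)) - (\<Sum>j\<le>n. f (Suc j) * u (n - j))"
      by (simp add: r_def sum_subtractf sum.distrib left_diff_distrib distrib_right)
    also have "(\<Sum>j\<le>n. f (Suc j) * u (n - j)) = u (Suc n)"
      by (simp add: renewal[of "Suc n"] sum.atLeast1_atMost_eq lessThan_Suc_atMost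
          del: sum.cl_ivl_Suc)
    finally show ?case using Suc by simp
  qed
  have conserved_S: "(\<Sum>j<S. r j * u (n - j)) = 1" if "n \<ge> S" for n
  proof -
    have "(\<Sum>j<S. r j * u (n - j)) = (\<Sum>j\<le>n. r j * u (n - j))"
      using that r0 by (intro sum.mono_neutral_left) auto
    then show ?thesis using conserved by simp
  qed
  \<comment> \<open>Summation by parts; the boundary term vanishes at \<open>m = S\<close>.\<close>
  have "(\<Sum>j<m. r j) = real m * r m + (\<Sum>j=1..m. real j * f j)" for m
    by (induction m) (auto simp: r_def algebra_simps)
  from this[of S] have r_sum: "(\<Sum>j<S. r j) = \<mu>" using r0 by (simp add: \<mu>_def)
  have "f j \<le> real j * f j" if "j \<in> {1..S}" for j
    using mult_right_mono[of 1 "real j" "f j"] nonneg that by simp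
  then have "(\<Sum>j=1..S. f j) \<le> \<mu>"
    unfolding \<mu>_def by (rule sum_mono)
  then have \<mu>: "\<mu> > 0" using sum1 by simp
  have "{j. j \<ge> 1 \<and> f j > 0} = {j \<in> {1..S}. f j > 0}"
    using support by (force simp: not_less[symmetric])
  with aperiodic have gcd: "Gcd {j \<in> {1..S}. f j > 0} = 1" by simp
  have above: "eventually (\<lambda>n. u n < 1 / \<mu> + e) sequentially" if "e > 0" for e
    using limsup_of_moving_average[of S f u B r 1 e] nonneg sum1 gcd average bounded
      conserved_S \<mu> r_sum that by simp
  have below: "eventually (\<lambda>n. - u n < - 1 / \<mu> + e) sequentially" if "e > 0" for e
    using limsup_of_moving_average[of S f "\<lambda>n. - u n" B r "-1" e] nonneg sum1 gcd average bounded
      conserved_S \<mu> r_sum that by (simp add: sum_negf)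
  show ?thesis
    unfolding \<mu>_def[symmetric]
  proof (rule order_tendstoI)
    fix a assume "a < 1 / \<mu>"
    then show "eventually (\<lambda>n. a < u n) sequentially"
      using below[of "1 / \<mu> - a"] by (simp add: algebra_simps)
  next
    fix a assume "1 / \<mu> < a"
    then show "eventually (\<lambda>n. u n < a) sequentially"
      using above[of "a - 1 / \<mu>"] by simp
  qed
qed

section \<open>Landing probabilities\<close>

context prob_space
begin

text \<open>
  Positive jumps make the positions strictly increasing, so almost surely square \<open>n\<close> is visited at
  most once, and only within the first \<open>n\<close> jumps. The bound \<open>N\<close> is left free so that
  landing probabilities of different squares can be written as sums over the same range.
\<close>

lemma landing_prob_eq_sum:
  assumes rv: "\<And>i. i \<ge> 1 \<Longrightarrow> X i \<in> measurable M (count_space UNIV)"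
    and pos: "\<And>i. i \<ge> 1 \<Longrightarrow> AE \<omega> in M. X i \<omega> \<ge> 1"
    and N: "n \<le> N"
  shows "landing_prob M X n = (\<Sum>k\<le>N. prob {\<omega> \<in> space M. (\<Sum>i=1..k. X i \<omega>) = n})"
proof -
  define T where "T k \<omega> = (\<Sum>i=1..k. X i \<omega>)" for k \<omega>
  have T_rv [measurable]: "T k \<in> measurable M (count_space UNIV)" for k
    unfolding T_def using rv by (intro measurable_sum_nat) auto
  note [measurable] = rv
  \<comment> \<open>The null event of a zero jump is cut out, so that the events are genuinely disjoint.\<close>
  define E where "E k = {\<omega> \<in> space M. T k \<omega> = n \<and> (\<forall>i\<in>{1..}. X i \<omega> \<ge> 1)}" for k
  have E_sets: "E k \<in> sets M" for k
    unfolding E_def by measurable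
  have good: "AE \<omega> in M. \<forall>i\<in>{1..}. X i \<omega> \<ge> 1"
    using pos by (subst AE_ball_countable) auto
  have mono: "strict_mono (\<lambda>k. T k \<omega>)" if "\<forall>i\<in>{1..}. X i \<omega> \<ge> 1" for \<omega>
    using that by (auto simp: strict_mono_Suc_iff T_def Suc_le_eq)
  have disj: "disjoint_family_on E {..N}"
    using strict_mono_eq[OF mono] by (fastforce simp: disjoint_family_on_def E_def)
  have "landing_prob M X n = prob (\<Union>k\<le>N. E k)"
    unfolding landing_prob_def T_def[symmetric]
  proof (rule measure_eq_AE)
    show "AE \<omega> in M. \<omega> \<in> {\<omega> \<in> space M. \<exists>k. T k \<omega> = n} \<longleftrightarrow> \<omega> \<in> (\<Union>k\<le>N. E k)"
      using good
    proof eventually_elim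
      case (elim \<omega>)
      have "k \<le> N" if "T k \<omega> = n" for k
        using strict_mono_imp_increasing[OF mono[OF elim], of k] that N by simp
      then show ?case using elim by (auto simp: E_def)
    qed
  qed (use E_sets in measurable)
  also have "\<dots> = (\<Sum>k\<le>N. prob (E k))"
    using E_sets disj by (intro finite_measure_finite_Union) auto
  also have "\<dots> = (\<Sum>k\<le>N. prob {\<omega> \<in> space M. T k \<omega> = n})"
  proof (intro sum.cong refl measure_eq_AE)
    fix k
    show "AE \<omega> in M. \<omega> \<in> E k \<longleftrightarrow> \<omega> \<in> {\<omega> \<in> space M. T k \<omega> = n}"
      using good by eventually_elim (auto simp: E_def)
  qed (use E_sets in measurable)
  finally show ?thesis by (simp add: T_def)
qed

text \<open>
  Conditioning on the last jump rather than on the first: the last jump is independent of the position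
  before it, and no shift of the sequence \<open>X\<close> is involved.
\<close>

lemma prob_partial_sum_Suc:
  fixes X :: "nat \<Rightarrow> 'a \<Rightarrow> nat"
  assumes indep: "indep_vars (\<lambda>_. count_space UNIV) X {1..}"
    and pos: "AE \<omega> in M. X (Suc k) \<omega> \<ge> 1"
  shows "prob {\<omega> \<in> space M. (\<Sum>i=1..Suc k. X i \<omega>) = n} =
    (\<Sum>j=1..n. prob {\<omega> \<in> space M. X (Suc k) \<omega> = j} * prob {\<omega> \<in> space M. (\<Sum>i=1..k. X i \<omega>) = n - j})"
proof -
  have rv [measurable]: "X i \<in> measurable M (count_space UNIV)" if "i \<ge> 1" for i
    using indep that by (auto simp: indep_vars_def)
  define T where "T \<omega> = (\<Sum>i=1..k. X i \<omega>)" for \<omega>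
  have T_rv [measurable]: "T \<in> measurable M (count_space UNIV)"
    unfolding T_def using rv by (intro measurable_sum_nat) auto
  have X_rv [measurable]: "X (Suc k) \<in> measurable M (count_space UNIV)" by (rule rv) simp
  \<comment> \<open>Casting to the reals fits the Borel-valued form of \<open>indep_vars_sum\<close>.\<close>
  have "indep_vars (\<lambda>_. borel) (\<lambda>i \<omega>. real (X i \<omega>)) {1..}"
    using indep by (rule indep_vars_compose2) simp
  then have "indep_vars (\<lambda>_. borel) (\<lambda>i \<omega>. real (X i \<omega>)) (insert (Suc k) {1..k})"
    by (rule indep_vars_subset) auto
  then have ind: "indep_var borel (\<lambda>\<omega>. real (X (Suc k) \<omega>)) borel (\<lambda>\<omega>. \<Sum>i=1..k. real (X i \<omega>))"
    by (intro indep_vars_sum) auto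
  have product: "prob {\<omega> \<in> space M. X (Suc k) \<omega> = j \<and> T \<omega> = m} =
      prob {\<omega> \<in> space M. X (Suc k) \<omega> = j} * prob {\<omega> \<in> space M. T \<omega> = m}" for j m
  proof -
    have T_real: "(\<Sum>i=1..k. real (X i \<omega>)) = real (T \<omega>)" for \<omega>
      by (simp add: T_def)
    have "(\<lambda>\<omega>. (real (X (Suc k) \<omega>), \<Sum>i=1..k. real (X i \<omega>))) -` ({real j} \<times> {real m}) \<inter> space M =
        {\<omega> \<in> space M. X (Suc k) \<omega> = j \<and> T \<omega> = m}"
      "(\<lambda>\<omega>. real (X (Suc k) \<omega>)) -` {real j} \<inter> space M = {\<omega> \<in> space M. X (Suc k) \<omega> = j}"
      "(\<lambda>\<omega>. \<Sum>i=1..k. real (X i \<omega>)) -` {real m} \<inter> space M = {\<omega> \<in> space M. T \<omega> = m}"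
      unfolding T_real by auto
    then show ?thesis
      using indep_varD[OF ind, of "{real j}" "{real m}"] by simp
  qed
  define E where "E j = {\<omega> \<in> space M. X (Suc k) \<omega> = j \<and> T \<omega> = n - j}" for j
  have E_sets: "E j \<in> sets M" for j unfolding E_def by measurable
  have "prob {\<omega> \<in> space M. (\<Sum>i=1..Suc k. X i \<omega>) = n} = prob {\<omega> \<in> space M. T \<omega> + X (Suc k) \<omega> = n}"
    by (simp add: T_def)
  also have "\<dots> = prob (\<Union>j\<in>{1..n}. E j)"
  proof (rule measure_eq_AE)
    show "AE \<omega> in M. \<omega> \<in> {\<omega> \<in> space M. T \<omega> + X (Suc k) \<omega> = n} \<longleftrightarrow> \<omega> \<in> (\<Union>j\<in>{1..n}. E j)"
      using pos by eventually_elim (auto simp: E_def)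
  qed (use E_sets in measurable)
  also have "\<dots> = (\<Sum>j=1..n. prob (E j))"
    using E_sets by (intro finite_measure_finite_Union) (auto simp: disjoint_family_on_def E_def)
  finally show ?thesis by (simp only: E_def product[unfolded T_def] T_def)
qed

lemma landing_prob_renewal:
  fixes X :: "nat \<Rightarrow> 'a \<Rightarrow> nat"
  assumes indep: "indep_vars (\<lambda>_. count_space UNIV) X {1..}"
    and pos: "\<And>i. i \<ge> 1 \<Longrightarrow> AE \<omega> in M. X i \<omega> \<ge> 1"
    and distr: "\<And>i j. i \<ge> 1 \<Longrightarrow> j \<ge> 1 \<Longrightarrow> prob {\<omega> \<in> space M. X i \<omega> = j} = f j"
    and n: "n \<ge> 1"
  shows "landing_prob M X n = (\<Sum>j=1..n. f j * landing_prob M X (n - j))"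
proof -
  define p where "p k m = prob {\<omega> \<in> space M. (\<Sum>i=1..k. X i \<omega>) = m}" for k m
  have rv: "X i \<in> measurable M (count_space UNIV)" if "i \<ge> 1" for i
    using indep that by (auto simp: indep_vars_def)
  have u: "landing_prob M X m = (\<Sum>k\<le>K. p k m)" if "m \<le> K" for m K
    unfolding p_def using rv pos that by (rule landing_prob_eq_sum)
  have step: "p (Suc k) n = (\<Sum>j=1..n. f j * p k (n - j))" for k
    unfolding p_def using distr by (subst prob_partial_sum_Suc[OF indep pos]) simp_all
  obtain n' where n': "n = Suc n'" using n by (cases n) auto
  have "landing_prob M X n = p 0 n + (\<Sum>k\<le>n'. p (Suc k) n)"
    unfolding u[OF order_refl] by (simp add: n' sum.atMost_Suc_shift del: sum.atMost_Suc)
  also have "p 0 n = 0" using n by (simp add: p_def)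
  also have "(\<Sum>k\<le>n'. p (Suc k) n) = (\<Sum>j=1..n. f j * (\<Sum>k\<le>n'. p k (n - j)))"
    unfolding step sum_distrib_left by (rule sum.swap)
  also have "\<dots> = (\<Sum>j=1..n. f j * landing_prob M X (n - j))"
    by (intro sum.cong refl arg_cong2[where f="(*)"] u[symmetric]) (auto simp: n')
  finally show ?thesis by simp
qed

lemma AE_mem_finite_range:
  fixes X :: "'a \<Rightarrow> nat"
  assumes X: "X \<in> measurable M (count_space UNIV)" and "finite J"
    and total: "(\<Sum>j\<in>J. prob {\<omega> \<in> space M. X \<omega> = j}) = 1"
  shows "AE \<omega> in M. X \<omega> \<in> J"
proof -
  note [measurable] = X
  have "prob (\<Union>j\<in>J. {\<omega> \<in> space M. X \<omega> = j}) = 1"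
    using total \<open>finite J\<close>
    by (subst finite_measure_finite_Union) (auto simp: disjoint_family_on_def)
  moreover have "(\<Union>j\<in>J. {\<omega> \<in> space M. X \<omega> = j}) = {\<omega> \<in> space M. X \<omega> \<in> J}" by auto
  ultimately show ?thesis by (subst prob_Collect_eq_1[symmetric]) auto
qed

lemma expectation_finite_range:
  fixes X :: "'a \<Rightarrow> nat"
  assumes X: "X \<in> measurable M (count_space UNIV)" and "finite J"
    and J: "AE \<omega> in M. X \<omega> \<in> J"
  shows "expectation (\<lambda>\<omega>. real (X \<omega>)) = (\<Sum>j\<in>J. real j * prob {\<omega> \<in> space M. X \<omega> = j})"
proof -
  note [measurable] = X
  have "expectation (\<lambda>\<omega>. real (X \<omega>)) =
      expectation (\<lambda>\<omega>. \<Sum>j\<in>J. real j * indicator {\<omega> \<in> space M. X \<omega> = j} \<omega>)"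
  proof (rule integral_cong_AE)
    show "AE \<omega> in M. real (X \<omega>) = (\<Sum>j\<in>J. real j * indicator {\<omega> \<in> space M. X \<omega> = j} \<omega>)"
      using J AE_space
    proof eventually_elim
      case (elim \<omega>)
      have "(\<Sum>j\<in>J. real j * indicator {\<omega> \<in> space M. X \<omega> = j} \<omega>) = (\<Sum>j\<in>J. if j = X \<omega> then real j else 0)"
        using elim by (intro sum.cong) (auto simp: indicator_def)
      then show ?case using elim \<open>finite J\<close> by simp
    qed
  qed measurable
  also have "\<dots> = (\<Sum>j\<in>J. real j * prob {\<omega> \<in> space M. X \<omega> = j})"
    by (subst Bochner_Integration.integral_sum) (auto simp: less_top[symmetric])
  finally show ?thesis .
qed

end

section \<open>The limit of the landing probabilities\<close>

theorem theorem2: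
  fixes f :: "nat \<Rightarrow> real"
    and N :: "'b measure" and X :: "'b \<Rightarrow> nat"
    and M :: "'a measure" and Xs :: "nat \<Rightarrow> 'a \<Rightarrow> nat"
  assumes f_nonneg: "\<And>j. j \<ge> 1 \<Longrightarrow> f j \<ge> 0"
    and f_sum: "(f has_sum 1) {1..}"
    and f_bounded_support: "\<exists>S. \<forall>j>S. f j = 0"
    and f_aperiodic: "Gcd {j. j \<ge> 1 \<and> f j > 0} = 1"
    and N: "prob_space N"
    and X_measurable: "X \<in> measurable N (count_space UNIV)"
    and X_distr: "\<And>j. j \<ge> 1 \<Longrightarrow> measure N {\<omega> \<in> space N. X \<omega> = j} = f j"
    and M: "prob_space M"
    and Xs_indep: "prob_space.indep_vars M (\<lambda>_. count_space UNIV) Xs {1..}"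
    and Xs_distr: "\<And>i. i \<ge> 1 \<Longrightarrow>
      distr M (count_space UNIV) (Xs i) = distr N (count_space UNIV) X"
  shows "landing_prob M Xs \<longlonglongrightarrow> 1 / prob_space.expectation N (\<lambda>\<omega>. real (X \<omega>))
    \<and> prob_space.expectation N (\<lambda>\<omega>. real (X \<omega>)) = (\<Sum>\<^sub>\<infinity>j\<in>{1..}. real j * f j)"
proof -
  interpret N: prob_space N by (rule N)
  interpret M: prob_space M by (rule M)
  obtain S where S: "\<And>j. j > S \<Longrightarrow> f j = 0" using f_bounded_support by blast
  have "(\<Sum>\<^sub>\<infinity>j\<in>{1..}. f j) = (\<Sum>\<^sub>\<infinity>j\<in>{1..S}. f j)"
    using S by (intro infsum_cong_neutral) auto
  then have sum1: "(\<Sum>j=1..S. f j) = 1" using infsumI[OF f_sum] by simp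
  have rv: "Xs i \<in> measurable M (count_space UNIV)" if "i \<ge> 1" for i
    using Xs_indep that by (auto simp: M.indep_vars_def)
  have Xs_prob: "measure M {\<omega> \<in> space M. Xs i \<omega> = j} = f j" if "i \<ge> 1" "j \<ge> 1" for i j
  proof -
    have "measure M {\<omega> \<in> space M. Xs i \<omega> = j} = measure (distr M (count_space UNIV) (Xs i)) {j}"
      using rv[OF that(1)] by (simp add: measure_distr vimage_def Int_def conj_commute)
    also have "\<dots> = measure N {\<omega> \<in> space N. X \<omega> = j}"
      using X_measurable Xs_distr[OF that(1)] by (simp add: measure_distr vimage_def Int_def conj_commute)
    finally show ?thesis using X_distr that by simp
  qed
  \<comment> \<open>The jump law is given on positive integers only; since its mass there is already 1,
    the value 0 is excluded almost surely.\<close>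
  have X_range: "AE \<omega> in N. X \<omega> \<in> {1..S}"
    using X_measurable X_distr sum1 by (intro N.AE_mem_finite_range) auto
  have Xs_pos: "AE \<omega> in M. Xs i \<omega> \<ge> 1" if "i \<ge> 1" for i
  proof -
    have "AE \<omega> in M. Xs i \<omega> \<in> {1..S}"
      using rv that Xs_prob sum1 by (intro M.AE_mem_finite_range) auto
    then show ?thesis by eventually_elim simp
  qed
  have "N.expectation (\<lambda>\<omega>. real (X \<omega>)) = (\<Sum>j\<in>{1..S}. real j * measure N {\<omega> \<in> space N. X \<omega> = j})"
    using X_measurable X_range by (intro N.expectation_finite_range) auto
  also have "\<dots> = (\<Sum>j=1..S. real j * f j)"
    using X_distr by (intro sum.cong) auto
  finally have mean: "N.expectation (\<lambda>\<omega>. real (X \<omega>)) = (\<Sum>j=1..S. real j * f j)" .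
  have "(\<Sum>\<^sub>\<infinity>j\<in>{1..}. real j * f j) = (\<Sum>\<^sub>\<infinity>j\<in>{1..S}. real j * f j)"
    using S by (intro infsum_cong_neutral) auto
  then have mean_infsum: "(\<Sum>\<^sub>\<infinity>j\<in>{1..}. real j * f j) = (\<Sum>j=1..S. real j * f j)" by simp
  have start: "landing_prob M Xs 0 = 1"
  proof -
    have "{\<omega> \<in> space M. \<exists>k. (\<Sum>i=1..k. Xs i \<omega>) = 0} = space M"
      by (auto intro!: exI[of _ 0])
    then show ?thesis by (simp add: landing_prob_def M.prob_space)
  qed
  have "landing_prob M Xs \<longlonglongrightarrow> 1 / (\<Sum>j=1..S. real j * f j)"
    using f_nonneg sum1 S f_aperiodic start
  proof (rule renewal_sequence_limit)
    show "landing_prob M Xs n = (\<Sum>j=1..n. f j * landing_prob M Xs (n - j))" if "n \<ge> 1" for n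
      using Xs_indep Xs_pos Xs_prob that by (rule M.landing_prob_renewal)
    show "\<bar>landing_prob M Xs n\<bar> \<le> 1" for n
      by (simp add: landing_prob_def)
  qed
  then show ?thesis by (simp only: mean mean_infsum)
qed

end
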